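(* For any $1\le p\le \infty$, $d_{S}^{(p)}$ is a pseudometric on the set of all barcodes of finite bounded type.
   Context: A barcode of finite bounded type is a (nonempty) finite multiset $\mathcal{B}=\{I_i\}_{i=1}^{n}$ of bounded intervals $I_i=(a_i,b_i]$ with $a_i<b_i$ real; an interval may appear multiple times. Gram matrix: let $f_i$ be the characteristic function of $I_i=(a_i,b_i]$ on $\mathbb{R}$. The Gram matrix of $\mathcal{B}$ is the $n\times n$ matrix $G_{\mathcal{B}}=(\langle f_i,f_j\rangle)_{i,j=1}^{n}$ with $\langle f_i,f_j\rangle=\int_{\mathbb{R}}\overline{f_j(x)}f_i(x)\,dx=\int_{(a_i,b_i]\cap(a_j,b_j]}1\,dx$. It is positive semi-definite with non-negative entries. Let $\|G_{\mathcal{B}}\|$ be its operator norm, and let $\widetilde{G}_{\mathcal{B}}=\frac{G_{\mathcal{B}}}{\|G_{\mathcal{B}}\|}\oplus\mathbf{0}$, where $\mathbf{0}$ is the zero operator on an infinite-dimensional space; so $\widetilde{G}_{\mathcal{B}}$ is the infinite matrix (indexed by $\mathbb{N}=\{1,2,\dots\}$) with upper-left $n\times n$ block $G_{\mathcal{B}}/\|G_{\mathcal{B}}\|$ and all other entries zero. Eigenvalue sequence: $\Lambda_{\mathcal{B}}=\{\lambda_i\}_{i=1}^{\infty}$ denotes the sequence of eigenvalues of $\widetilde{G}_{\mathcal{B}}$ listed with multiplicity, i.e. the $n$ eigenvalues of $G_{\mathcal{B}}/\|G_{\mathcal{B}}\|$ (with multiplicity) together with infinitely many zeros. All are non-negative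 and only finitely many are nonzero. Pseudo-distance: for barcodes $\mathcal{B},\mathcal{C}$ of finite bounded type with eigenvalue sequences $\Lambda_{\mathcal{B}}=\{\lambda_i\}_{i=1}^{\infty}$ and $\Lambda_{\mathcal{C}}=\{\mu_j\}_{j=1}^{\infty}$, and $1\le p\le\infty$, $$d_{S}^{(p)}(\mathcal{B},\mathcal{C})=\inf_{\sigma}\sqrt[p]{\sum_{i=1}^{\infty}|\lambda_i-\mu_{\sigma(i)}|^{p}},$$ where $\sigma$ ranges over all bijections $\sigma:\mathbb{N}\to\mathbb{N}$; for $p=\infty$ the expression under the infimum is read in the usual way as $\sup_i|\lambda_i-\mu_{\sigma(i)}|$. A pseudometric is a function satisfying all the axioms of a metric (non-negativity, zero self-distance, symmetry, triangle inequality), except that the distance between two different elements may be zero. *)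

theory Defs
  imports
    "HOL-Analysis.Lebesgue_Measure"
    "HOL-Library.Multiset"
    "Jordan_Normal_Form.Char_Poly"
begin

definition pseudometric_on :: "'a set \<Rightarrow> ('a \<Rightarrow> 'a \<Rightarrow> real) \<Rightarrow> bool" where
  "pseudometric_on M d \<longleftrightarrow>
     (\<forall>x\<in>M. \<forall>y\<in>M. 0 \<le> d x y) \<and>
     (\<forall>x\<in>M. d x x = 0) \<and>
     (\<forall>x\<in>M. \<forall>y\<in>M. d x y = d y x) \<and>
     (\<forall>x\<in>M. \<forall>y\<in>M. \<forall>z\<in>M. d x z \<le> d x y + d y z)"

text \<open>A bar is the half-open interval itself, as a set of reals; since \<open>a < b\<close>, it determines its
  endpoints.\<close>

definition finite_bounded_barcodes :: "real set multiset set" where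
  "finite_bounded_barcodes =
     {B. B \<noteq> {#} \<and> (\<forall>I\<in>#B. \<exists>a b. a < b \<and> I = {a<..b})}"

definition gram_mat :: "real set list \<Rightarrow> real mat" where
  "gram_mat Is = Matrix.mat (length Is) (length Is)
     (\<lambda>(i, j). LINT x|lborel. indicat_real (Is ! j) x * indicat_real (Is ! i) x)"

text \<open>The operator norm for the Euclidean norm, written as in the library's \<open>onorm\<close> (so the zero
  vector contributes \<open>0 / 0 = 0\<close>). That constant itself does not apply, because matrices of variable
  size act on carrier sets and not on types.\<close>

definition vec_norm :: "real vec \<Rightarrow> real" where
  "vec_norm v = sqrt (scalar_prod v v)"

definition op_norm :: "real mat \<Rightarrow> real" where
  "op_norm A = (SUP v\<in>carrier_vec (dim_col A). vec_norm (A *\<^sub>v v) / vec_norm v)"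

definition normalized_gram_mat :: "real set list \<Rightarrow> real mat" where
  "normalized_gram_mat Is = inverse (op_norm (gram_mat Is)) \<cdot>\<^sub>m gram_mat Is"

text \<open>The eigenvalues, with multiplicity, of the normalised Gram matrix extended by the zero operator
  on an infinite-dimensional space: the roots of the characteristic polynomial of the finite block
  (it splits over the reals, the block being symmetric), followed by zeros. A multiset of bars carries
  no order, so some enumeration of it is picked; another one conjugates the Gram matrix by a
  permutation matrix and leaves the sequence unchanged. The sequence is indexed from \<open>0\<close>.\<close>

definition eigenvalue_seq :: "real set multiset \<Rightarrow> nat \<Rightarrow> real" where
  "eigenvalue_seq B i =
     (let Is = (SOME Is. mset Is = B);
          es = sorted_list_of_multiset (proots (char_poly (normalized_gram_mat Is)))
      in if i < length es then es ! i else 0)"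

text \<open>The \<open>\<ell>\<^sup>p\<close> norm. It is applied to finitely supported sequences only, for which the series and the
  supremum are finite.\<close>

definition lp_norm :: "ereal \<Rightarrow> (nat \<Rightarrow> real) \<Rightarrow> real" where
  "lp_norm p u =
     (if p = \<infinity> then SUP i. \<bar>u i\<bar>
      else (\<Sum>i. \<bar>u i\<bar> powr real_of_ereal p) powr (1 / real_of_ereal p))"

definition spectral_dist :: "ereal \<Rightarrow> real set multiset \<Rightarrow> real set multiset \<Rightarrow> real" where
  "spectral_dist p B C =
     (INF \<sigma>\<in>{\<sigma>. bij \<sigma>}. lp_norm p (\<lambda>i. eigenvalue_seq B i - eigenvalue_seq C (\<sigma> i)))"

end

theory Submission
  imports Defs
begin

text \<open>
  The spectral distance of two barcodes is a function of their eigenvalue sequences. Each of these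
  sequences has finite support, because it consists of the roots of a polynomial followed by zeros
  (\<open>eigenvalue_seq_finite_support\<close>). On the finitely supported real sequences, the \<open>\<ell>\<^sup>p\<close> distance
  minimised over all rearrangements of one argument is a pseudometric, and the spectral distance is
  the pullback of that pseudometric.

  The \<open>\<ell>\<^sup>p\<close> norm is invariant under bijections of the index set
  (\<open>lp_norm_bij\<close>), so a bijection \<open>\<sigma>\<close> between two sequences and its inverse have the same cost,
  which gives symmetry. For the triangle inequality, two bijections \<open>\<sigma>\<close> and \<open>\<tau>\<close> are composed:
  \<open>a - c \<circ> \<tau> \<circ> \<sigma> = (a - b \<circ> \<sigma>) + (b - c \<circ> \<tau>) \<circ> \<sigma>\<close>, so Minkowski's inequality (\<open>lp_norm_triangle\<close>)
  and invariance show that the cost of the composite is at most the sum of the two costs. Passing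
  to the infimum over \<open>\<sigma>\<close> and \<open>\<tau>\<close> separately gives the claim. For finite \<open>p\<close>, Minkowski's inequality
  is a consequence of the convexity of \<open>x \<mapsto> x\<^sup>p\<close>.
\<close>

section \<open>Minkowski's inequality for finite sums\<close>

text \<open>The convexity of the power function on the open half-line extends to the end point \<open>0\<close>
  because \<open>t\<^sup>r \<le> t\<close> for \<open>0 \<le> t \<le> 1\<close>.\<close>

lemma powr_convex_nonneg:
  fixes r s t x y :: real
  assumes r: "1 \<le> r" and s: "0 \<le> s" and t: "0 \<le> t" and st: "s + t = 1"
    and x: "0 \<le> x" and y: "0 \<le> y"
  shows "(s * x + t * y) powr r \<le> s * x powr r + t * y powr r"
proof -
  have le: "(c * z) powr r \<le> c * z powr r" if "0 \<le> c" "c \<le> 1" "0 \<le> z" for c z :: real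
  proof -
    have "c powr r \<le> c"
      using powr_mono'[of 1 r c] that r by simp
    then show ?thesis
      using that by (simp add: powr_mult mult_right_mono)
  qed
  consider "x = 0" | "y = 0" | "x > 0" "y > 0"
    using x y by fastforce
  then show ?thesis
  proof cases
    case 1
    then show ?thesis using le[of t y] s t st y by simp
  next
    case 2
    then show ?thesis using le[of s x] s t st x by simp
  next
    case 3
    have "s = 1 - t" using st by simp
    then show ?thesis
      using convex_onD[OF powr_convex[OF r], of t x y] 3 s t by simp
  qed
qed

lemma minkowski_finite_sum:
  fixes f g :: "'a \<Rightarrow> real"
  assumes S: "finite S" and r: "1 \<le> r"
  shows "(\<Sum>i\<in>S. \<bar>f i + g i\<bar> powr r) powr (1 / r)
    \<le> (\<Sum>i\<in>S. \<bar>f i\<bar> powr r) powr (1 / r) + (\<Sum>i\<in>S. \<bar>g i\<bar> powr r) powr (1 / r)"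
proof -
  define A where "A = (\<Sum>i\<in>S. \<bar>f i\<bar> powr r) powr (1 / r)"
  define B where "B = (\<Sum>i\<in>S. \<bar>g i\<bar> powr r) powr (1 / r)"
  have Apow: "A powr r = (\<Sum>i\<in>S. \<bar>f i\<bar> powr r)" and Bpow: "B powr r = (\<Sum>i\<in>S. \<bar>g i\<bar> powr r)"
    using r by (simp_all add: A_def B_def powr_powr sum_nonneg)
  have zero: "\<forall>i\<in>S. h i = 0" if "(\<Sum>i\<in>S. \<bar>h i\<bar> powr r) = 0" for h :: "'a \<Rightarrow> real"
    using that S by (simp add: sum_nonneg_eq_0_iff)
  have "0 \<le> A" "0 \<le> B"
    by (simp_all add: A_def B_def)
  then consider "A = 0" | "B = 0" | "A > 0" "B > 0"
    by fastforce
  then have "(\<Sum>i\<in>S. \<bar>f i + g i\<bar> powr r) powr (1 / r) \<le> A + B"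
  proof cases
    case 1
    then have "\<forall>i\<in>S. f i = 0"
      using Apow by (intro zero) simp
    then show ?thesis using 1 by (simp add: B_def)
  next
    case 2
    then have "\<forall>i\<in>S. g i = 0"
      using Bpow by (intro zero) simp
    then show ?thesis using 2 by (simp add: A_def)
  next
    case 3
    define s where "s = A / (A + B)"
    define t where "t = B / (A + B)"
    have st: "0 \<le> s" "0 \<le> t" "s + t = 1"
      using 3 by (simp_all add: s_def t_def flip: add_divide_distrib)
    \<comment> \<open>\<open>\<bar>f i\<bar> + \<bar>g i\<bar>\<close> is \<open>A + B\<close> times a convex combination of the entries of the two normalised
      families, whose \<open>r\<close>-th powers sum to \<open>1\<close>.\<close>
    have pointwise: "\<bar>f i + g i\<bar> powr r
        \<le> (A + B) powr r * (s * (\<bar>f i\<bar> powr r / A powr r) + t * (\<bar>g i\<bar> powr r / B powr r))" for i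
    proof -
      have eq: "\<bar>f i\<bar> + \<bar>g i\<bar> = (A + B) * (s * (\<bar>f i\<bar> / A) + t * (\<bar>g i\<bar> / B))"
        using 3 by (simp add: s_def t_def divide_simps)
      have "\<bar>f i + g i\<bar> powr r \<le> (\<bar>f i\<bar> + \<bar>g i\<bar>) powr r"
        using r by (intro powr_mono2) (auto simp: abs_triangle_ineq)
      also have "\<dots> = (A + B) powr r * (s * (\<bar>f i\<bar> / A) + t * (\<bar>g i\<bar> / B)) powr r"
        unfolding eq by (rule powr_mult)
      also have "\<dots> \<le> (A + B) powr r * (s * (\<bar>f i\<bar> / A) powr r + t * (\<bar>g i\<bar> / B) powr r)"
        using 3 st r by (intro mult_left_mono powr_convex_nonneg) auto
      finally show ?thesis
        using 3 by (simp add: powr_divide)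
    qed
    have "(\<Sum>i\<in>S. \<bar>f i + g i\<bar> powr r)
        \<le> (\<Sum>i\<in>S. (A + B) powr r * (s * (\<bar>f i\<bar> powr r / A powr r) + t * (\<bar>g i\<bar> powr r / B powr r)))"
      by (intro sum_mono pointwise)
    also have "\<dots> = (A + B) powr r * (s * ((\<Sum>i\<in>S. \<bar>f i\<bar> powr r) / A powr r)
        + t * ((\<Sum>i\<in>S. \<bar>g i\<bar> powr r) / B powr r))"
      by (simp add: sum.distrib flip: sum_distrib_left sum_divide_distrib)
    also have "\<dots> = (A + B) powr r"
      using 3 st by (simp flip: Apow Bpow)
    finally have "(\<Sum>i\<in>S. \<bar>f i + g i\<bar> powr r) powr (1 / r) \<le> ((A + B) powr r) powr (1 / r)"
      using r by (intro powr_mono2) (auto intro: sum_nonneg)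
    then show ?thesis
      using 3 r by (simp add: powr_powr)
  qed
  then show ?thesis
    by (simp add: A_def B_def)
qed

section \<open>The \<open>\<ell>\<^sup>p\<close> norm of finitely supported sequences\<close>

definition finite_support_seqs :: "(nat \<Rightarrow> real) set" where
  "finite_support_seqs = {u. finite {i. u i \<noteq> 0}}"

lemma finite_support_seqs_diff:
  assumes "u \<in> finite_support_seqs" "v \<in> finite_support_seqs"
  shows "(\<lambda>i. u i - v i) \<in> finite_support_seqs"
proof -
  have "{i. u i - v i \<noteq> 0} \<subseteq> {i. u i \<noteq> 0} \<union> {i. v i \<noteq> 0}"
    by auto
  then show ?thesis
    using assms finite_subset by (fastforce simp: finite_support_seqs_def)
qed

lemma finite_support_seqs_bij:
  assumes "u \<in> finite_support_seqs" "bij \<sigma>"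
  shows "(\<lambda>i. u (\<sigma> i)) \<in> finite_support_seqs"
proof -
  have "{i. u (\<sigma> i) \<noteq> 0} = \<sigma> -` {i. u i \<noteq> 0}"
    by auto
  also have "finite \<dots>"
    using assms by (intro finite_vimageI) (auto simp: finite_support_seqs_def bij_is_inj)
  finally show ?thesis
    by (simp add: finite_support_seqs_def)
qed

lemma lp_norm_eq_sum:
  assumes "p \<noteq> \<infinity>" "finite S" "\<And>i. i \<notin> S \<Longrightarrow> u i = 0"
  shows "lp_norm p u
    = (\<Sum>i\<in>S. \<bar>u i\<bar> powr real_of_ereal p) powr (1 / real_of_ereal p)"
proof -
  have "(\<Sum>i. \<bar>u i\<bar> powr real_of_ereal p) = (\<Sum>i\<in>S. \<bar>u i\<bar> powr real_of_ereal p)"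
    using assms by (intro suminf_finite) auto
  then show ?thesis
    using assms by (simp add: lp_norm_def)
qed

lemma bdd_above_abs_finite_support:
  assumes "u \<in> finite_support_seqs"
  shows "bdd_above (range (\<lambda>i. \<bar>u i\<bar>))"
proof -
  have "range u \<subseteq> insert 0 (u ` {i. u i \<noteq> 0})"
    by auto
  then have "finite (range u)"
    using assms by (auto simp: finite_support_seqs_def intro: finite_subset)
  then show ?thesis
    by (simp add: range_composition[of abs u] flip: image_image)
qed

lemma lp_norm_nonneg:
  assumes "u \<in> finite_support_seqs"
  shows "0 \<le> lp_norm p u"
proof (cases "p = \<infinity>")
  case True
  have "0 \<le> \<bar>u 0\<bar>" by simp
  also have "\<dots> \<le> (SUP i. \<bar>u i\<bar>)"
    by (intro cSUP_upper bdd_above_abs_finite_support assms) simp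
  finally show ?thesis
    using True by (simp add: lp_norm_def)
qed (simp add: lp_norm_def)

lemma lp_norm_zero: "lp_norm p (\<lambda>_. 0) = 0"
  by (simp add: lp_norm_def)

lemma lp_norm_uminus: "lp_norm p (\<lambda>i. - u i) = lp_norm p u"
  by (simp add: lp_norm_def)

text \<open>Only for finite \<open>p\<close> is there something to reindex, and finite support turns the series into a
  finite sum, for which reindexing along a bijection is available; for \<open>p = \<infinity>\<close> the two sets of
  values coincide.\<close>

lemma lp_norm_bij:
  assumes u: "u \<in> finite_support_seqs" and \<sigma>: "bij \<sigma>"
  shows "lp_norm p (\<lambda>i. u (\<sigma> i)) = lp_norm p u"
proof (cases "p = \<infinity>")
  case True
  have "range (\<lambda>i. \<bar>u (\<sigma> i)\<bar>) = (\<lambda>i. \<bar>u i\<bar>) ` range \<sigma>"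
    by auto
  then show ?thesis
    using True \<sigma> by (simp add: lp_norm_def bij_is_surj)
next
  case False
  define S where "S = {i. u i \<noteq> 0}"
  have S: "finite S"
    using u by (simp add: S_def finite_support_seqs_def)
  have norm_u: "lp_norm p u = (\<Sum>i\<in>S. \<bar>u i\<bar> powr real_of_ereal p) powr (1 / real_of_ereal p)"
    by (rule lp_norm_eq_sum[OF False S]) (simp add: S_def)
  have norm_u\<sigma>: "lp_norm p (\<lambda>i. u (\<sigma> i))
      = (\<Sum>i\<in>\<sigma> -` S. \<bar>u (\<sigma> i)\<bar> powr real_of_ereal p) powr (1 / real_of_ereal p)"
    by (rule lp_norm_eq_sum[OF False finite_vimageI[OF S bij_is_inj[OF \<sigma>]]]) (simp add: S_def)
  have "bij_betw \<sigma> (\<sigma> -` S) S"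
    using \<sigma> by (auto simp: bij_betw_def surj_image_vimage_eq intro: inj_on_subset)
  then have "(\<Sum>i\<in>\<sigma> -` S. \<bar>u (\<sigma> i)\<bar> powr real_of_ereal p) = (\<Sum>i\<in>S. \<bar>u i\<bar> powr real_of_ereal p)"
    by (rule sum.reindex_bij_betw)
  then show ?thesis
    by (simp only: norm_u norm_u\<sigma>)
qed

lemma lp_norm_triangle:
  assumes p: "1 \<le> p" and u: "u \<in> finite_support_seqs" and v: "v \<in> finite_support_seqs"
  shows "lp_norm p (\<lambda>i. u i + v i) \<le> lp_norm p u + lp_norm p v"
proof (cases "p = \<infinity>")
  case True
  have "\<bar>u i + v i\<bar> \<le> (SUP i. \<bar>u i\<bar>) + (SUP i. \<bar>v i\<bar>)" for i
  proof -
    have "\<bar>u i\<bar> \<le> (SUP i. \<bar>u i\<bar>)" "\<bar>v i\<bar> \<le> (SUP i. \<bar>v i\<bar>)"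
      using u v by (auto intro!: cSUP_upper bdd_above_abs_finite_support)
    then show ?thesis by linarith
  qed
  then show ?thesis
    using True by (auto simp: lp_norm_def intro!: cSUP_least)
next
  case False
  define S where "S = {i. u i \<noteq> 0} \<union> {i. v i \<noteq> 0}"
  have S: "finite S"
    using u v by (simp add: S_def finite_support_seqs_def)
  have r: "1 \<le> real_of_ereal p"
    using p False by (cases p) auto
  show ?thesis
    using minkowski_finite_sum[OF S r, of u v]
      lp_norm_eq_sum[OF False S, of u] lp_norm_eq_sum[OF False S, of v]
      lp_norm_eq_sum[OF False S, of "\<lambda>i. u i + v i"]
    by (simp add: S_def)
qed

section \<open>The distance up to rearrangement\<close>

definition rearrangement_dist :: "ereal \<Rightarrow> (nat \<Rightarrow> real) \<Rightarrow> (nat \<Rightarrow> real) \<Rightarrow> real" where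
  "rearrangement_dist p a b = (INF \<sigma>\<in>{\<sigma>. bij \<sigma>}. lp_norm p (\<lambda>i. a i - b (\<sigma> i)))"

lemma ex_bij: "{\<sigma> :: nat \<Rightarrow> nat. bij \<sigma>} \<noteq> {}"
  using bij_id by blast

context
  fixes a b :: "nat \<Rightarrow> real"
  assumes a: "a \<in> finite_support_seqs" and b: "b \<in> finite_support_seqs"
begin

lemma rearranged_diff_finite_support:
  "bij \<sigma> \<Longrightarrow> (\<lambda>i. a i - b (\<sigma> i)) \<in> finite_support_seqs"
  by (rule finite_support_seqs_diff[OF a finite_support_seqs_bij[OF b]])

lemma rearrangement_dist_nonneg: "0 \<le> rearrangement_dist p a b"
  unfolding rearrangement_dist_def
  by (intro cINF_greatest ex_bij) (simp add: lp_norm_nonneg rearranged_diff_finite_support)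

lemma rearrangement_dist_le:
  assumes "bij \<sigma>"
  shows "rearrangement_dist p a b \<le> lp_norm p (\<lambda>i. a i - b (\<sigma> i))"
  unfolding rearrangement_dist_def
proof (rule cINF_lower)
  show "bdd_below ((\<lambda>\<sigma>. lp_norm p (\<lambda>i. a i - b (\<sigma> i))) ` {\<sigma>. bij \<sigma>})"
    by (rule bdd_belowI2[of _ 0]) (simp add: lp_norm_nonneg rearranged_diff_finite_support)
qed (use assms in simp)

end

lemma rearrangement_dist_self:
  assumes "a \<in> finite_support_seqs"
  shows "rearrangement_dist p a a = 0"
proof (rule antisym)
  show "rearrangement_dist p a a \<le> 0"
    using rearrangement_dist_le[OF assms assms bij_id] by (simp add: lp_norm_zero)
qed (rule rearrangement_dist_nonneg[OF assms assms])

lemma rearrangement_dist_commute_le: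
  assumes a: "a \<in> finite_support_seqs" and b: "b \<in> finite_support_seqs"
  shows "rearrangement_dist p b a \<le> rearrangement_dist p a b"
  unfolding rearrangement_dist_def[of p a b]
proof (intro cINF_greatest ex_bij)
  fix \<sigma> :: "nat \<Rightarrow> nat"
  assume "\<sigma> \<in> {\<sigma>. bij \<sigma>}"
  then have \<sigma>: "bij \<sigma>" by simp
  \<comment> \<open>Rearranging \<open>b - a \<circ> \<sigma>\<^sup>-\<^sup>1\<close> by \<open>\<sigma>\<close> gives \<open>b \<circ> \<sigma> - a\<close>.\<close>
  have "rearrangement_dist p b a \<le> lp_norm p (\<lambda>i. b i - a (inv_into UNIV \<sigma> i))"
    by (intro rearrangement_dist_le a b bij_imp_bij_inv \<sigma>)
  also have "\<dots> = lp_norm p (\<lambda>i. b (\<sigma> i) - a (inv_into UNIV \<sigma> (\<sigma> i)))"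
    by (rule lp_norm_bij[symmetric])
      (intro rearranged_diff_finite_support a b bij_imp_bij_inv \<sigma>, rule \<sigma>)
  also have "\<dots> = lp_norm p (\<lambda>i. a i - b (\<sigma> i))"
    using lp_norm_uminus[of p "\<lambda>i. a i - b (\<sigma> i)"] \<sigma> by (simp add: bij_is_inj)
  finally show "rearrangement_dist p b a \<le> lp_norm p (\<lambda>i. a i - b (\<sigma> i))" .
qed

lemma rearrangement_dist_triangle:
  assumes p: "1 \<le> p"
    and a: "a \<in> finite_support_seqs" and b: "b \<in> finite_support_seqs" and c: "c \<in> finite_support_seqs"
  shows "rearrangement_dist p a c \<le> rearrangement_dist p a b + rearrangement_dist p b c"
proof -
  have le: "rearrangement_dist p a c
      \<le> lp_norm p (\<lambda>i. a i - b (\<sigma> i)) + lp_norm p (\<lambda>i. b i - c (\<tau> i))"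
    if \<sigma>: "bij \<sigma>" and \<tau>: "bij \<tau>" for \<sigma> \<tau>
  proof -
    note ab = rearranged_diff_finite_support[OF a b \<sigma>]
    note bc = rearranged_diff_finite_support[OF b c \<tau>]
    have "rearrangement_dist p a c \<le> lp_norm p (\<lambda>i. a i - c ((\<tau> \<circ> \<sigma>) i))"
      by (intro rearrangement_dist_le a c bij_comp \<sigma> \<tau>)
    also have "\<dots> = lp_norm p (\<lambda>i. (a i - b (\<sigma> i)) + (b (\<sigma> i) - c (\<tau> (\<sigma> i))))"
      by simp
    also have "\<dots> \<le> lp_norm p (\<lambda>i. a i - b (\<sigma> i)) + lp_norm p (\<lambda>i. b (\<sigma> i) - c (\<tau> (\<sigma> i)))"
      by (rule lp_norm_triangle[OF p ab finite_support_seqs_bij[OF bc \<sigma>]])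
    also have "lp_norm p (\<lambda>i. b (\<sigma> i) - c (\<tau> (\<sigma> i))) = lp_norm p (\<lambda>i. b i - c (\<tau> i))"
      by (rule lp_norm_bij[OF bc \<sigma>])
    finally show ?thesis .
  qed
  \<comment> \<open>The two bijections vary independently, so the infima can be taken one after the other.\<close>
  have "rearrangement_dist p a c - rearrangement_dist p b c \<le> lp_norm p (\<lambda>i. a i - b (\<sigma> i))"
    if \<sigma>: "bij \<sigma>" for \<sigma>
  proof -
    have "rearrangement_dist p a c - lp_norm p (\<lambda>i. a i - b (\<sigma> i)) \<le> rearrangement_dist p b c"
      unfolding rearrangement_dist_def[of p b c]
      using le[OF \<sigma>] by (intro cINF_greatest ex_bij) (simp add: diff_le_eq add.commute)
    then show ?thesis by linarith
  qed
  then have "rearrangement_dist p a c - rearrangement_dist p b c \<le> rearrangement_dist p a b"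
    unfolding rearrangement_dist_def[of p a b] by (intro cINF_greatest ex_bij) simp
  then show ?thesis by linarith
qed

lemma pseudometric_on_rearrangement_dist:
  assumes "1 \<le> p"
  shows "pseudometric_on finite_support_seqs (rearrangement_dist p)"
  unfolding pseudometric_on_def
  using rearrangement_dist_nonneg rearrangement_dist_self rearrangement_dist_triangle[OF assms]
  by (auto intro!: antisym rearrangement_dist_commute_le)

section \<open>The spectral distance of barcodes\<close>

lemma eigenvalue_seq_finite_support: "eigenvalue_seq B \<in> finite_support_seqs"
proof -
  define es where
    "es = sorted_list_of_multiset (proots (char_poly (normalized_gram_mat (SOME Is. mset Is = B))))"
  have "{i. eigenvalue_seq B i \<noteq> 0} \<subseteq> {..<length es}"
    by (auto simp: eigenvalue_seq_def es_def Let_def split: if_splits)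
  then show ?thesis
    by (auto simp: finite_support_seqs_def intro: finite_subset)
qed

lemma spectral_dist_eq_rearrangement_dist:
  "spectral_dist p B C = rearrangement_dist p (eigenvalue_seq B) (eigenvalue_seq C)"
  by (simp add: spectral_dist_def rearrangement_dist_def)

theorem theorem3p1:
  fixes p :: ereal
  assumes "1 \<le> p"
  shows "pseudometric_on finite_bounded_barcodes (spectral_dist p)"
  using pseudometric_on_rearrangement_dist[OF assms] eigenvalue_seq_finite_support
  by (simp add: pseudometric_on_def spectral_dist_eq_rearrangement_dist)

end
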